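(* Let $\mathbf x:[0,s_{max}]\to\mathbb R^3$ be the spatial part of a cuspless sub-Riemannian geodesic of $\mathbf{P_{mec}}$, i.e. let $\mathbf x$ be a stationary curve of $\mathbf{P_{curve}}$. Then for any $s\in(0,s_{max}]$ one has that $\mathbf e_z$, $\mathbf x(s)$ and $\mathbf x'(s)$ are coplanar if and only if $\mathbf x$ is a planar curve, i.e. $$\mathbf e_z\cdot(\mathbf x(s)\times\mathbf x'(s))=0\iff W=0.$$
   Context: Throughout $\xi=1$. Problem $\mathbf{P_{curve}}$: minimize $\int_0^L\sqrt{1+\kappa^2(s)}\,ds$ ($L$ free) among arclength-parametrized curves $\mathbf x$ in $\mathbb R^3$ with $\mathbf x(0)=\mathbf 0$, $\mathbf x'(0)=\mathbf e_z$ and prescribed $\mathbf x(L),\mathbf x'(L)$. Its stationary curves are the spatial projections $\mathbf x$ of cuspless sub-Riemannian geodesics $\gamma=(\mathbf x,R)$ of $\mathbf{P_{mec}}$ (the lifted sub-Riemannian problem on $SE(3)/(\{\mathbf 0\}\times SO(2))$, sixth momentum component $\lambda_6=0$), which are described in spatial arclength $s$ as follows. The momentum is $\lambda_1(s)=\lambda_1(0)\cosh s-\lambda_5(0)\sinh s$, $\lambda_5(s)=\lambda_5(0)\cosh s-\lambda_1(0)\sinh s$, $\lambda_2(s)=\lambda_2(0)\cosh s+\lambda_4(0)\sinh s$, $\lambda_4(s)=\lambda_4(0)\cosh s+\lambda_2(0)\sinh s$, $\lambda_3(s)=\sqrt{1-\lambda_4(s)^2-\lambda_5(s)^2}$, with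 $(\lambda_1,\lambda_2,\lambda_3)(0)\neq\mathbf 0$ and $\lambda_4(0)^2+\lambda_5(0)^2\le1$; $s_{max}\in(0,\infty]$ is the minimal $s>0$ with $\lambda_3(s)=0$ (if infinite, $[0,s_{max}]$ means $[0,\infty)$); $\gamma(0)=(\mathbf 0,I)$ and for $0<s<s_{max}$ $$\mathbf x'(s)=R(s)\mathbf e_z,\qquad R'(s)=\frac1{\lambda_3(s)}R(s)\begin{pmatrix}0&0&\lambda_5(s)\\0&0&-\lambda_4(s)\\-\lambda_5(s)&\lambda_4(s)&0\end{pmatrix}.$$ The constant $W=-\lambda_1\lambda_4-\lambda_2\lambda_5$ is a first integral. *)

theory Defs
  imports "HOL-Analysis.Analysis"
begin

text \<open>
  Momentum of a geodesic as a function of the spatial arclength \<open>s\<close>; the parameters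
  \<open>a1\<close>, \<open>a2\<close>, \<open>a4\<close>, \<open>a5\<close> are the initial values
  \<open>\<lambda>\<^sub>1(0)\<close>, \<open>\<lambda>\<^sub>2(0)\<close>, \<open>\<lambda>\<^sub>4(0)\<close>, \<open>\<lambda>\<^sub>5(0)\<close>.
\<close>

definition lam1 :: "real \<Rightarrow> real \<Rightarrow> real \<Rightarrow> real" where
  "lam1 a1 a5 s = a1 * cosh s - a5 * sinh s"

definition lam5 :: "real \<Rightarrow> real \<Rightarrow> real \<Rightarrow> real" where
  "lam5 a1 a5 s = a5 * cosh s - a1 * sinh s"

definition lam2 :: "real \<Rightarrow> real \<Rightarrow> real \<Rightarrow> real" where
  "lam2 a2 a4 s = a2 * cosh s + a4 * sinh s"

definition lam4 :: "real \<Rightarrow> real \<Rightarrow> real \<Rightarrow> real" where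
  "lam4 a2 a4 s = a4 * cosh s + a2 * sinh s"

text \<open>
  The library's \<open>sqrt\<close> is extended to negative arguments as an odd function. The formula below
  is therefore meaningful only where \<open>\<lambda>\<^sub>4\<^sup>2 + \<lambda>\<^sub>5\<^sup>2 \<le> 1\<close>; \<open>cuspless_geodesic\<close> requires this
  inequality wherever \<open>\<lambda>\<^sub>3\<close> is used.
\<close>

definition lam3 :: "real \<Rightarrow> real \<Rightarrow> real \<Rightarrow> real \<Rightarrow> real \<Rightarrow> real" where
  "lam3 a1 a2 a4 a5 s = sqrt (1 - (lam4 a2 a4 s)\<^sup>2 - (lam5 a1 a5 s)\<^sup>2)"

definition W_integral :: "real \<Rightarrow> real \<Rightarrow> real \<Rightarrow> real \<Rightarrow> real" where
  "W_integral a1 a2 a4 a5 = - a1 * a4 - a2 * a5"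

lemma W_integral_first_integral:
  "- lam1 a1 a5 s * lam4 a2 a4 s - lam2 a2 a4 s * lam5 a1 a5 s = W_integral a1 a2 a4 a5"
proof -
  have "- lam1 a1 a5 s * lam4 a2 a4 s - lam2 a2 a4 s * lam5 a1 a5 s
      = (- a1 * a4 - a2 * a5) * ((cosh s)\<^sup>2 - (sinh s)\<^sup>2)"
    unfolding lam1_def lam2_def lam4_def lam5_def
    by (simp add: algebra_simps power2_eq_square)
  then show ?thesis
    by (simp add: W_integral_def cosh_square_eq)
qed

text \<open>
  The first zero of \<open>\<lambda>\<^sub>3\<close> after \<open>0\<close>, with \<open>Inf {} = \<infinity>\<close>. When the infimum is finite and positive,
  it is attained by continuity of \<open>\<lambda>\<^sub>3\<close>, so it is the minimal zero. Positivity is part of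
  \<open>cuspless_geodesic\<close>.
\<close>

definition s_max :: "real \<Rightarrow> real \<Rightarrow> real \<Rightarrow> real \<Rightarrow> ereal" where
  "s_max a1 a2 a4 a5 = Inf (ereal ` {s. 0 < s \<and> lam3 a1 a2 a4 a5 s = 0})"

definition geodesic_domain :: "real \<Rightarrow> real \<Rightarrow> real \<Rightarrow> real \<Rightarrow> real set" where
  "geodesic_domain a1 a2 a4 a5 = {s. 0 \<le> s \<and> ereal s \<le> s_max a1 a2 a4 a5}"

definition e_z :: "real^3" where
  "e_z = axis 3 1"

definition frame_generator :: "real \<Rightarrow> real \<Rightarrow> real^3^3" where
  "frame_generator l4 l5 = vector [vector [0, 0, l5], vector [0, 0, - l4], vector [- l5, l4, 0]]"

text \<open>
  \<open>(x, R)\<close> is a continuous curve in \<open>SE(3)\<close> on the closed interval from \<open>0\<close> to \<open>s_max\<close> that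
  solves the geodesic equations in its interior. The equation for \<open>R\<close> is singular at any end point
  where \<open>\<lambda>\<^sub>3\<close> vanishes, so only continuity is required at the end points.
\<close>

definition cuspless_geodesic ::
    "real \<Rightarrow> real \<Rightarrow> real \<Rightarrow> real \<Rightarrow> (real \<Rightarrow> real^3) \<Rightarrow> (real \<Rightarrow> real^3^3) \<Rightarrow> bool" where
  "cuspless_geodesic a1 a2 a4 a5 x R \<longleftrightarrow>
     a4\<^sup>2 + a5\<^sup>2 \<le> 1 \<and>
     (a1, a2, lam3 a1 a2 a4 a5 0) \<noteq> (0, 0, 0) \<and>
     0 < s_max a1 a2 a4 a5 \<and>
     (\<forall>s. 0 < s \<and> ereal s < s_max a1 a2 a4 a5 \<longrightarrow> (lam4 a2 a4 s)\<^sup>2 + (lam5 a1 a5 s)\<^sup>2 \<le> 1) \<and>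
     continuous_on (geodesic_domain a1 a2 a4 a5) x \<and>
     continuous_on (geodesic_domain a1 a2 a4 a5) R \<and>
     (\<forall>s\<in>geodesic_domain a1 a2 a4 a5. rotation_matrix (R s)) \<and>
     x 0 = 0 \<and> R 0 = mat 1 \<and>
     (\<forall>s. 0 < s \<and> ereal s < s_max a1 a2 a4 a5 \<longrightarrow>
        (x has_vector_derivative R s *v e_z) (at s) \<and>
        (R has_vector_derivative
           (1 / lam3 a1 a2 a4 a5 s) *\<^sub>R (R s ** frame_generator (lam4 a2 a4 s) (lam5 a1 a5 s)))
          (at s))"

text \<open>The derivative \<open>x'\<close> along the geodesic; it is one-sided at the end points of the domain.\<close>

definition velocity ::
    "real \<Rightarrow> real \<Rightarrow> real \<Rightarrow> real \<Rightarrow> (real \<Rightarrow> real^3) \<Rightarrow> real \<Rightarrow> real^3" where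
  "velocity a1 a2 a4 a5 x s = vector_derivative x (at s within geodesic_domain a1 a2 a4 a5)"

text \<open>
  The library's \<open>coplanar\<close> is an affine notion on sets of points: vectors are coplanar iff together
  with the origin they lie in a common plane.
\<close>

definition coplanar_vectors :: "real^3 \<Rightarrow> real^3 \<Rightarrow> real^3 \<Rightarrow> bool" where
  "coplanar_vectors u v w \<longleftrightarrow> coplanar {0, u, v, w}"

definition planar_curve :: "real set \<Rightarrow> (real \<Rightarrow> real^3) \<Rightarrow> bool" where
  "planar_curve I x \<longleftrightarrow> coplanar (x ` I)"

end

theory Submission
  imports Defs
begin

text \<open>
  Let \<open>A(s) = x'(s)\<close> be the tangent. The spatial linear momentum \<open>p\<close> is constant, the angular momentum
  \<open>q = \<lambda>\<^sub>4 R e\<^sub>x + \<lambda>\<^sub>5 R e\<^sub>y\<close> satisfies \<open>q' = p \<times> A\<close>, \<open>p \<bullet> q = -W\<close>, and the central projection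
  \<open>g = A / \<lambda>\<^sub>3\<close> of the tangent to the plane \<open>p \<bullet> g = 1\<close> satisfies \<open>g' = -(p \<times> q) / \<lambda>\<^sub>3\<^sup>3\<close>. So \<open>g\<close> is a
  locally convex planar curve for \<open>W \<noteq> 0\<close>, and its direction turns by less than \<open>\<pi>\<close>:
  \<open>F(a, t) = W det(p, q(a), q(t))\<close> solves the non-oscillating equation
  \<open>(F' / \<lambda>\<^sub>3)' = |p|\<^sup>2 F / \<lambda>\<^sub>3\<^sup>3\<close>, where the derivatives are in \<open>t\<close>, hence \<open>F(a, t) > 0\<close> for \<open>a < t\<close>. Therefore
  \<open>W det(A(t\<^sub>0), A(t\<^sub>1), A(t\<^sub>2)) > 0\<close> whenever \<open>t\<^sub>0 < t\<^sub>1 < t\<^sub>2\<close>, and integration over \<open>t\<^sub>1\<close> gives the sign of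
  \<open>W det(e\<^sub>z, x(s), x'(s))\<close>. All strict inequalities are proved in the open interval and carried to the
  possibly singular end points by limits; a vanishing limit would force \<open>A(s)\<close> parallel to \<open>A(0)\<close>,
  which the sign of \<open>F(0, s)\<close> or the monotonicity of \<open>g \<bullet> q(s)\<close> excludes.
\<close>

section \<open>Determinants and coplanarity in three-space\<close>

lemma triple_product_expansion:
  fixes a b c n :: "real^3"
  shows "(a \<bullet> cross3 b c) *\<^sub>R n =
    (n \<bullet> a) *\<^sub>R cross3 b c + (n \<bullet> b) *\<^sub>R cross3 c a + (n \<bullet> c) *\<^sub>R cross3 a b"
  by (simp add: cross3_simps forall_3)

text \<open>A singular matrix with rows \<open>a\<close>, \<open>b\<close>, \<open>c\<close> has a
  kernel vector, which is the normal \<open>n\<close>. Conversely, the expansion of \<open>n\<close>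
  in the basis reciprocal to \<open>a\<close>, \<open>b\<close>, \<open>c\<close> has zero
  coefficients, so the determinant times \<open>n\<close> vanishes.\<close>

lemma triple_product_eq_0_iff:
  fixes a b c :: "real^3"
  shows "a \<bullet> cross3 b c = 0 \<longleftrightarrow> (\<exists>n. n \<noteq> 0 \<and> n \<bullet> a = 0 \<and> n \<bullet> b = 0 \<and> n \<bullet> c = 0)"
proof
  assume "a \<bullet> cross3 b c = 0"
  then obtain n :: "real^3" where n: "n \<noteq> 0" "(vector [a, b, c] :: real^3^3) *v n = 0"
    by (metis dot_cross_det invertible_det_nz invertible_left_inverse matrix_left_invertible_ker)
  then have "a \<bullet> n = 0" "b \<bullet> n = 0" "c \<bullet> n = 0"
    by (auto simp: vec_eq_iff forall_3 matrix_vector_mul_component)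
  with n(1) show "\<exists>n. n \<noteq> 0 \<and> n \<bullet> a = 0 \<and> n \<bullet> b = 0 \<and> n \<bullet> c = 0"
    by (metis inner_commute)
next
  assume "\<exists>n. n \<noteq> 0 \<and> n \<bullet> a = 0 \<and> n \<bullet> b = 0 \<and> n \<bullet> c = 0"
  then obtain n where "n \<noteq> 0" "n \<bullet> a = 0" "n \<bullet> b = 0" "n \<bullet> c = 0"
    by blast
  then show "a \<bullet> cross3 b c = 0"
    using triple_product_expansion[of a b c n] by simp
qed

text \<open>As \<open>0\<close> lies in \<open>S\<close>, affine and linear dimension agree. Three
  points have affine dimension at most 2, so \<open>S\<close> spans a proper subspace and has a
  normal; conversely, a hyperplane through \<open>0\<close> is spanned by two vectors.\<close>

lemma coplanar_iff_orthogonal: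
  fixes S :: "(real^3) set"
  assumes "0 \<in> S"
  shows "coplanar S \<longleftrightarrow> (\<exists>n. n \<noteq> 0 \<and> (\<forall>v\<in>S. n \<bullet> v = 0))"
proof
  assume "coplanar S"
  then obtain u v w where S: "S \<subseteq> affine hull {u, v, w}"
    by (auto simp: coplanar_def)
  have "aff_dim S \<le> aff_dim {u, v, w}"
    using aff_dim_subset[OF S] by simp
  also have "\<dots> \<le> int (card {u, v, w}) - 1"
    by (rule aff_dim_le_card) simp
  also have "\<dots> \<le> 2"
    by (simp add: card_insert_if)
  finally have "dim S < DIM(real^3)"
    using aff_dim_zero[of S] assms by (simp add: hull_inc)
  then obtain n where "n \<noteq> 0" "span S \<subseteq> {v. n \<bullet> v = 0}"
    using lowdim_subset_hyperplane by blast
  then show "\<exists>n. n \<noteq> 0 \<and> (\<forall>v\<in>S. n \<bullet> v = 0)"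
    using span_superset by blast
next
  assume "\<exists>n. n \<noteq> 0 \<and> (\<forall>v\<in>S. n \<bullet> v = 0)"
  then obtain n where n: "n \<noteq> 0" "S \<subseteq> {v. n \<bullet> v = 0}"
    by auto
  have "dim {v. n \<bullet> v = 0} = 2"
    using dim_hyperplane[OF n(1)] by simp
  then obtain B where B: "{v. n \<bullet> v = 0} \<subseteq> span B" "card B = 2"
    by (metis basis_exists)
  then obtain u v where "B = {u, v}"
    by (auto simp: card_2_iff)
  then have "S \<subseteq> affine hull {0, u, v}"
    using n(2) B(1) by (simp add: affine_hull_insert_span_gen affine_hull_span_0 hull_inc span_insert_0)
  then show "coplanar S"
    by (auto simp: coplanar_def)
qed

section \<open>Calculus of vector-valued functions and a positivity principle for linear
  systems\<close>

lemma vector_3_eq_axis: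
  "(vector [a, b, c] :: real^3) = a *\<^sub>R axis 1 1 + b *\<^sub>R axis 2 1 + c *\<^sub>R axis 3 1"
  by (simp add: vec_eq_iff forall_3 axis_def)

lemma has_vector_derivative_vector_3:
  assumes "(f has_real_derivative f') (at t)" "(g has_real_derivative g') (at t)"
    "(h has_real_derivative h') (at t)"
  shows "((\<lambda>t. vector [f t, g t, h t] :: real^3) has_vector_derivative vector [f', g', h']) (at t)"
  unfolding vector_3_eq_axis using assms
  by (auto intro!: derivative_eq_intros)

lemma bounded_bilinear_matrix_vector_mult:
  "bounded_bilinear ((*v) :: real^'n^'m \<Rightarrow> real^'n \<Rightarrow> real^'m)"
  unfolding bilinear_conv_bounded_bilinear[symmetric] bilinear_def
  by (auto intro!: linearI simp: matrix_vector_mult_add_rdistrib matrix_vector_right_distrib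
      scaleR_matrix_vector_assoc matrix_vector_mult_scaleR)

text \<open>The product \<open>u * v\<close> is nondecreasing, vanishes at \<open>a\<close> and has
  positive derivative there. Hence it is nonzero elsewhere on \<open>I\<close>, so \<open>v\<close>
  has no zero and keeps its sign at \<open>a\<close>.\<close>

lemma cooperative_system_pos:
  fixes u v \<alpha> \<beta> :: "real \<Rightarrow> real"
  assumes I: "is_interval I" "a \<in> I"
    and u: "\<And>t. t \<in> I \<Longrightarrow> (u has_real_derivative \<alpha> t * v t) (at t)"
    and v: "\<And>t. t \<in> I \<Longrightarrow> (v has_real_derivative \<beta> t * u t) (at t)"
    and \<alpha>: "\<And>t. t \<in> I \<Longrightarrow> 0 < \<alpha> t" and \<beta>: "\<And>t. t \<in> I \<Longrightarrow> 0 \<le> \<beta> t"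
    and init: "u a = 0" "0 < v a"
    and b: "b \<in> I"
  shows "0 < v b"
proof -
  have Icc: "{c..d} \<subseteq> I" if "c \<in> I" "d \<in> I" for c d
    using I(1) that by (meson atLeastAtMost_iff is_interval_1 subsetI)
  have uv: "((\<lambda>t. u t * v t) has_real_derivative \<alpha> t * (v t)\<^sup>2 + \<beta> t * (u t)\<^sup>2) (at t)"
    if "t \<in> I" for t
    by (rule derivative_eq_intros u v that refl | simp add: power2_eq_square algebra_simps)+
  have mono: "u c * v c \<le> u d * v d" if "c \<le> d" "c \<in> I" "d \<in> I" for c d
  proof (rule DERIV_nonneg_imp_nondecreasing[OF \<open>c \<le> d\<close>])
    fix t assume "c \<le> t" "t \<le> d"
    then have "t \<in> I" using Icc[OF that(2,3)] by auto
    then show "\<exists>y. ((\<lambda>t. u t * v t) has_real_derivative y) (at t) \<and> 0 \<le> y"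
      using uv \<alpha> \<beta> by (meson add_nonneg_nonneg less_imp_le mult_nonneg_nonneg zero_le_power2)
  qed
  have pos: "0 < \<alpha> a * (v a)\<^sup>2 + \<beta> a * (u a)\<^sup>2"
    using \<alpha>[OF I(2)] init by simp
  have nz: "v t \<noteq> 0" if t: "t \<in> I" for t
  proof (cases t a rule: linorder_cases)
    case greater
    obtain d where d: "d > 0" "\<And>h. 0 < h \<Longrightarrow> h < d \<Longrightarrow> u a * v a < u (a + h) * v (a + h)"
      using DERIV_pos_inc_right[OF uv[OF I(2)] pos] by auto
    \<comment> \<open>\<open>a + h\<close> lies to the right of \<open>a\<close>, not beyond
      \<open>t\<close>, and close enough for \<open>u * v\<close> to be positive already;
      monotonicity carries this to \<open>t\<close>.\<close>
    define h where "h = min (t - a) (d / 2)"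
    have h: "0 < h" "h < d" "a + h \<le> t"
      using d greater by (auto simp: h_def)
    then have "a + h \<in> I"
      using Icc[OF I(2) t] by auto
    then have "0 < u t * v t"
      using d(2)[OF h(1,2)] mono[OF h(3) _ t] init by simp
    then show ?thesis by auto
  next
    case less
    obtain d where d: "d > 0" "\<And>h. 0 < h \<Longrightarrow> h < d \<Longrightarrow> u (a - h) * v (a - h) < u a * v a"
      using DERIV_pos_inc_left[OF uv[OF I(2)] pos] by auto
    define h where "h = min (a - t) (d / 2)"
    have h: "0 < h" "h < d" "t \<le> a - h"
      using d less by (auto simp: h_def)
    then have "a - h \<in> I"
      using Icc[OF t I(2)] by auto
    then have "u t * v t < 0"
      using d(2)[OF h(1,2)] mono[OF h(3) t] init by simp
    then show ?thesis by auto
  qed (use init in auto)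
  have "continuous_on I v"
    using v by (meson DERIV_isCont continuous_at_imp_continuous_on)
  then have "connected (v ` I)"
    using I(1) connected_continuous_image is_interval_connected by blast
  then have "is_interval (v ` I)"
    by (simp add: is_interval_connected_1)
  then show ?thesis
    using nz init(2) I(2) b
    by (smt (verit) image_iff imageI is_interval_1)
qed

lemma dot_cross_cross:
  fixes a b c d :: "real^3"
  shows "cross3 a b \<bullet> cross3 c d = (a \<bullet> c) * (b \<bullet> d) - (a \<bullet> d) * (b \<bullet> c)"
  by (simp add: cross3_simps)

lemma triple_product_rotate:
  fixes a b c :: "real^3"
  shows "a \<bullet> cross3 b c = cross3 a b \<bullet> c"
  by (simp add: cross3_simps)

lemma has_real_derivative_inner_right:
  assumes "(f has_vector_derivative f') (at t)"
  shows "((\<lambda>t. u \<bullet> f t) has_real_derivative u \<bullet> f') (at t)"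
  using bounded_linear.has_vector_derivative[OF bounded_linear_inner_right assms]
  by (simp add: has_real_derivative_iff_has_vector_derivative)

lemma inner_vector_3:
  "(vector [a, b, c] :: real^3) \<bullet> vector [a', b', c'] = a * a' + b * b' + c * c'"
  by (simp add: inner_vec_def sum_3)

lemma double_cross: "cross3 a (cross3 b a) = (a \<bullet> a) *\<^sub>R b - (a \<bullet> b) *\<^sub>R a"
  by (simp add: cross3_simps forall_3)

lemmas tendsto_cross3 =
  bounded_bilinear.tendsto[OF bilinear_conv_bounded_bilinear[THEN iffD1, OF bilinear_cross]]

section \<open>The closed domain, its interior, and limits from the interior\<close>

locale cuspless_curve =
  fixes a1 a2 a4 a5 :: real and x :: "real \<Rightarrow> real^3" and R :: "real \<Rightarrow> real^3^3"
  assumes geodesic: "cuspless_geodesic a1 a2 a4 a5 x R"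
begin

abbreviation "l1 \<equiv> lam1 a1 a5"
abbreviation "l2 \<equiv> lam2 a2 a4"
abbreviation "l3 \<equiv> lam3 a1 a2 a4 a5"
abbreviation "l4 \<equiv> lam4 a2 a4"
abbreviation "l5 \<equiv> lam5 a1 a5"
abbreviation "W \<equiv> W_integral a1 a2 a4 a5"
abbreviation "D \<equiv> geodesic_domain a1 a2 a4 a5"

definition "I = {t. 0 < t \<and> ereal t < s_max a1 a2 a4 a5}"
definition "tangent t = R t *v e_z"
definition "linear_momentum t = R t *v vector [l1 t, l2 t, l3 t]"
definition "angular_momentum t = R t *v vector [l4 t, l5 t, 0]"

abbreviation "p \<equiv> linear_momentum 0"
abbreviation "q \<equiv> angular_momentum"

lemma interior_subset: "t \<in> I \<Longrightarrow> t \<in> D"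
  by (auto simp: I_def geodesic_domain_def)

lemma zero_in_domain: "0 \<in> D"
  using geodesic by (auto simp: geodesic_domain_def cuspless_geodesic_def zero_ereal_def)

lemma interior_below: "t \<in> D \<Longrightarrow> 0 < r \<Longrightarrow> r < t \<Longrightarrow> r \<in> I"
  by (auto simp: I_def geodesic_domain_def intro: less_le_trans[of "ereal r" "ereal t"])

lemma domain_below: "t \<in> D \<Longrightarrow> 0 \<le> r \<Longrightarrow> r \<le> t \<Longrightarrow> r \<in> D"
  by (auto simp: geodesic_domain_def intro: order_trans[of "ereal r" "ereal t"])

lemma is_interval_interior: "is_interval I"
  unfolding is_interval_1 I_def
  by (auto intro: le_less_trans[of "ereal _" "ereal _"])

lemma interior_nonempty: "\<exists>c. c \<in> I"
proof -
  have "0 < s_max a1 a2 a4 a5"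
    using geodesic by (simp add: cuspless_geodesic_def)
  then obtain c where "ereal 0 < ereal c" "ereal c < s_max a1 a2 a4 a5"
    using ereal_dense2[of "ereal 0"] by (auto simp: zero_ereal_def)
  then show ?thesis by (auto simp: I_def)
qed

text \<open>Contracting towards an interior point moves all of \<open>D\<close> into
  \<open>I\<close> at once. For \<open>e\<close> tending to 0 from above, this transfers
  inequalities to end points where the differential equations are not assumed.\<close>

lemma contraction_interior:
  assumes "c \<in> I" "t \<in> D" "0 < e" "e < 1"
  shows "t + e * (c - t) \<in> I"
proof -
  have eq: "t + e * (c - t) = (1 - e) * t + e * c"
    by (simp add: algebra_simps)
  have pos: "0 < t + e * (c - t)"
    unfolding eq using assms by (simp add: I_def geodesic_domain_def add_nonneg_pos)
  show ?thesis
  proof (cases "t \<le> c")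
    case True
    then have "t + e * (c - t) \<le> c"
      using assms mult_right_mono[of e 1 "c - t"] by simp
    then show ?thesis
      using pos assms(1) by (auto simp: I_def intro: le_less_trans[of "ereal _" "ereal c"])
  next
    case False
    then have "t + e * (c - t) < t"
      using assms by (simp add: mult_pos_neg)
    then show ?thesis
      using pos assms(2) interior_below by blast
  qed
qed

lemma tendsto_contraction:
  assumes f: "continuous_on D f" and "c \<in> I" "t \<in> D"
  shows "((\<lambda>e. f (t + e * (c - t))) \<longlongrightarrow> f t) (at_right 0)"
proof -
  have lim: "((\<lambda>e. t + e * (c - t)) \<longlongrightarrow> t) (at_right 0)"
    by (auto intro!: tendsto_eq_intros)
  have ev: "eventually (\<lambda>e. t + e * (c - t) \<in> D) (at_right (0::real))"
    using eventually_at_right_less[of 0] eventually_at_right_real[of 0 1]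
    by (auto elim!: eventually_mono intro!: interior_subset contraction_interior assms)
  show ?thesis
    by (rule continuous_on_tendsto_compose[OF f lim \<open>t \<in> D\<close> ev])
qed

text \<open>The bound on the momentum makes the square root nonnegative, and a zero at
  \<open>t\<close> would force \<open>s_max\<close> down to \<open>t\<close>.\<close>

lemma l3_pos: assumes "t \<in> I" shows "0 < l3 t"
proof -
  have t: "0 < t" "ereal t < s_max a1 a2 a4 a5"
    using assms by (auto simp: I_def)
  have "0 \<le> l3 t"
    using geodesic t by (auto simp: cuspless_geodesic_def lam3_def diff_le_eq)
  moreover have "l3 t \<noteq> 0"
  proof
    assume "l3 t = 0"
    then have "s_max a1 a2 a4 a5 \<le> ereal t"
      unfolding s_max_def using t(1) by (auto intro: Inf_lower)
    then show False using t(2) by simp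
  qed
  ultimately show ?thesis by simp
qed

section \<open>Evolution of the frame and of the momenta\<close>

lemma has_derivative_lam:
  "(l1 has_real_derivative - l5 t) (at t)"
  "(l2 has_real_derivative l4 t) (at t)"
  "(l4 has_real_derivative l2 t) (at t)"
  "(l5 has_real_derivative - l1 t) (at t)"
  unfolding lam1_def lam2_def lam4_def lam5_def
  by (auto intro!: derivative_eq_intros)

lemma has_derivative_l3:
  assumes "t \<in> I"
  shows "(l3 has_real_derivative (l1 t * l5 t - l2 t * l4 t) / l3 t) (at t)"
proof -
  have "0 < 1 - (l4 t)\<^sup>2 - (l5 t)\<^sup>2"
    using l3_pos[OF assms] by (simp add: lam3_def)
  then show ?thesis
    unfolding lam3_def
    by (auto intro!: derivative_eq_intros has_derivative_lam simp: field_simps)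
qed

lemma continuous_lam:
  "continuous_on S l1" "continuous_on S l2" "continuous_on S l3"
  "continuous_on S l4" "continuous_on S l5"
  unfolding lam1_def lam2_def lam3_def lam4_def lam5_def
  by (auto intro!: continuous_intros)

lemma l3_nonneg: assumes "t \<in> D" shows "0 \<le> l3 t"
proof -
  obtain c where c: "c \<in> I" using interior_nonempty by blast
  show ?thesis
  proof (rule tendsto_lowerbound[OF tendsto_contraction[OF continuous_lam(3) c assms]])
    show "eventually (\<lambda>e. 0 \<le> l3 (t + e * (c - t))) (at_right 0)"
      using eventually_at_right_real[of 0 1]
      by (auto elim!: eventually_mono intro!: less_imp_le[OF l3_pos] contraction_interior assms c)
  qed simp
qed

lemma rotation: "t \<in> D \<Longrightarrow> rotation_matrix (R t)"
  using geodesic by (auto simp: cuspless_geodesic_def)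

lemma inner_rotation: "t \<in> D \<Longrightarrow> (R t *v u) \<bullet> (R t *v v) = u \<bullet> v"
  using rotation unfolding rotation_matrix_def
  by (metis matrix_of_matrix_vector_mul matrix_vector_mul_linear orthogonal_transformation_def
      orthogonal_transformation_matrix)

lemma cross_rotation: "t \<in> D \<Longrightarrow> cross3 (R t *v u) (R t *v v) = R t *v cross3 u v"
  using rotation cross_rotation_matrix by blast

lemma e_z_vector: "e_z = vector [0, 0, 1]"
  by (simp add: e_z_def vec_eq_iff forall_3 axis_def)

text \<open>Product rule for a vector given by its coordinates in the moving frame: the motion of
  \<open>R\<close> adds the generator applied to these coordinates, divided by
  \<open>l3\<close>.\<close>

lemma has_derivative_frame:
  assumes "t \<in> I" "(b1 has_real_derivative b1') (at t)" "(b2 has_real_derivative b2') (at t)"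
    "(b3 has_real_derivative b3') (at t)"
  shows "((\<lambda>t. R t *v vector [b1 t, b2 t, b3 t]) has_vector_derivative
    R t *v vector [b1' + l5 t * b3 t / l3 t, b2' - l4 t * b3 t / l3 t,
      b3' + (l4 t * b2 t - l5 t * b1 t) / l3 t]) (at t)"
proof -
  have R': "(R has_vector_derivative
      (1 / l3 t) *\<^sub>R (R t ** frame_generator (l4 t) (l5 t))) (at t)"
    using geodesic assms(1) by (auto simp: cuspless_geodesic_def I_def)
  have "frame_generator (l4 t) (l5 t) *v vector [b1 t, b2 t, b3 t] =
      vector [l5 t * b3 t, - l4 t * b3 t, l4 t * b2 t - l5 t * b1 t]"
    by (simp add: vec_eq_iff forall_3 matrix_vector_mult_def sum_3 frame_generator_def)
  then have "R t *v vector [b1', b2', b3'] +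
      ((1 / l3 t) *\<^sub>R (R t ** frame_generator (l4 t) (l5 t))) *v vector [b1 t, b2 t, b3 t] =
      R t *v (vector [b1', b2', b3'] +
        (1 / l3 t) *\<^sub>R vector [l5 t * b3 t, - l4 t * b3 t, l4 t * b2 t - l5 t * b1 t])"
    by (simp add: scaleR_matrix_vector_assoc[symmetric] matrix_vector_mul_assoc[symmetric]
        matrix_vector_right_distrib matrix_vector_mult_scaleR)
  also have "vector [b1', b2', b3'] +
        (1 / l3 t) *\<^sub>R vector [l5 t * b3 t, - l4 t * b3 t, l4 t * b2 t - l5 t * b1 t] =
      (vector [b1' + l5 t * b3 t / l3 t, b2' - l4 t * b3 t / l3 t,
        b3' + (l4 t * b2 t - l5 t * b1 t) / l3 t] :: real^3)"
    by (simp add: vec_eq_iff forall_3)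
  finally show ?thesis
    using bounded_bilinear.has_vector_derivative[OF bounded_bilinear_matrix_vector_mult R'
        has_vector_derivative_vector_3[OF assms(2-4)]] by simp
qed

lemma continuous_frame:
  assumes "continuous_on D b1" "continuous_on D b2" "continuous_on D b3"
  shows "continuous_on D (\<lambda>t. R t *v vector [b1 t, b2 t, b3 t])"
proof -
  have "continuous_on D (\<lambda>t. vector [b1 t, b2 t, b3 t] :: real^3)"
    unfolding vector_3_eq_axis
    using assms by (auto intro!: continuous_intros)
  moreover have "continuous_on D R"
    using geodesic by (simp add: cuspless_geodesic_def)
  ultimately show ?thesis
    by (intro bounded_bilinear.continuous_on[OF bounded_bilinear_matrix_vector_mult])
qed

lemma continuous_tangent: "continuous_on D tangent"
  unfolding tangent_def e_z_vector by (intro continuous_frame continuous_intros)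

lemma continuous_angular_momentum: "continuous_on D q"
  unfolding angular_momentum_def by (intro continuous_frame continuous_lam continuous_intros)

lemma linear_momentum_const:
  assumes "t \<in> D" shows "linear_momentum t = p"
proof (cases "t = 0")
  case False
  then have t: "0 < t" using assms by (simp add: geodesic_domain_def)
  \<comment> \<open>Testing against an arbitrary \<open>u\<close> reduces constancy to a real
    function: zero derivative inside, continuity at the ends.\<close>
  have "u \<bullet> linear_momentum t = u \<bullet> p" for u
  proof (rule DERIV_isconst_end[OF t])
    have "continuous_on D linear_momentum"
      unfolding linear_momentum_def by (intro continuous_frame continuous_lam)
    then show "continuous_on {0..t} (\<lambda>t. u \<bullet> linear_momentum t)"
      by (intro continuous_intros) (auto elim!: continuous_on_subset intro: domain_below[OF assms])
  next
    fix r assume "0 < r" "r < t"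
    then have r: "r \<in> I" using interior_below assms by blast
    have zero: "(vector [0, 0, 0] :: real^3) = 0"
      by (simp add: vec_eq_iff forall_3)
    have "(linear_momentum has_vector_derivative 0) (at r)"
      unfolding linear_momentum_def
      using has_derivative_frame[OF r has_derivative_lam(1,2) has_derivative_l3[OF r]] l3_pos[OF r]
      by (simp add: add_divide_distrib[symmetric] algebra_simps zero)
    from bounded_linear.has_vector_derivative[OF bounded_linear_inner_right this, of u]
    show "((\<lambda>t. u \<bullet> linear_momentum t) has_real_derivative 0) (at r)"
      by (simp add: has_real_derivative_iff_has_vector_derivative)
  qed
  then show ?thesis by (metis vector_eq_ldot)
qed simp

lemma tangent_unit: "t \<in> D \<Longrightarrow> tangent t \<bullet> tangent t = 1"
  by (simp add: tangent_def inner_rotation e_z_def inner_axis_axis)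

lemma tangent_dot_angular: "t \<in> D \<Longrightarrow> tangent t \<bullet> q t = 0"
  by (simp add: tangent_def angular_momentum_def inner_rotation e_z_vector inner_vector_3)

lemma momentum_dot_tangent: "t \<in> D \<Longrightarrow> p \<bullet> tangent t = l3 t"
  by (simp add: linear_momentum_const[symmetric, of t])
    (simp add: linear_momentum_def tangent_def inner_rotation e_z_vector inner_vector_3)

lemma momentum_dot_angular:
  assumes "t \<in> D" shows "p \<bullet> q t = - W"
proof -
  have "p \<bullet> q t = l1 t * l4 t + l2 t * l5 t"
    using linear_momentum_const[OF assms, symmetric] assms
    by (simp add: linear_momentum_def angular_momentum_def inner_rotation inner_vector_3)
  then show ?thesis
    using W_integral_first_integral[of a1 a5 t a2 a4] by simp
qed

text \<open>In the moving frame the right-hand side is \<open>(l2, - l1, 0)\<close>, the derivative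
  of \<open>(l4, l5, 0)\<close>; the rotation of the frame contributes nothing, since its third
  component \<open>(l4 * l5 - l5 * l4) / l3\<close> cancels.\<close>

lemma has_derivative_angular_momentum:
  assumes "t \<in> I"
  shows "(q has_vector_derivative cross3 p (tangent t)) (at t)"
proof -
  have "cross3 p (tangent t) = R t *v cross3 (vector [l1 t, l2 t, l3 t]) (vector [0, 0, 1])"
    using interior_subset[OF assms]
    by (simp add: linear_momentum_const[symmetric, of t])
      (simp add: linear_momentum_def tangent_def e_z_vector cross_rotation)
  also have "cross3 (vector [l1 t, l2 t, l3 t]) (vector [0, 0, 1]) = vector [l2 t, - l1 t, 0]"
    by (simp add: cross3_def)
  finally show ?thesis
    unfolding angular_momentum_def
    using has_derivative_frame[OF assms has_derivative_lam(3,4) DERIV_const[of 0]] by simp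
qed

section \<open>Turning of the projected tangent\<close>

definition "projected_tangent t = (1 / l3 t) *\<^sub>R tangent t"

abbreviation "g \<equiv> projected_tangent"

text \<open>In the moving frame \<open>g\<close> is \<open>(0, 0, 1 / l3)\<close>. The rotation
  yields the first two coordinates of the derivative, and differentiating \<open>1 / l3\<close>
  yields the third.\<close>

lemma has_derivative_projected_tangent:
  assumes "t \<in> I"
  shows "(g has_vector_derivative - (1 / l3 t ^ 3) *\<^sub>R cross3 p (q t)) (at t)"
proof -
  have nz: "l3 t \<noteq> 0" using l3_pos[OF assms] by simp
  have "cross3 p (q t) =
      R t *v cross3 (vector [l1 t, l2 t, l3 t]) (vector [l4 t, l5 t, 0])"
    using interior_subset[OF assms]
    by (simp add: linear_momentum_const[symmetric, of t])
      (simp add: linear_momentum_def angular_momentum_def cross_rotation)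
  then have "- (1 / l3 t ^ 3) *\<^sub>R cross3 p (q t) = R t *v
      (- (1 / l3 t ^ 3) *\<^sub>R cross3 (vector [l1 t, l2 t, l3 t]) (vector [l4 t, l5 t, 0]))"
    by (simp only: matrix_vector_mult_scaleR)
  also have "- (1 / l3 t ^ 3) *\<^sub>R cross3 (vector [l1 t, l2 t, l3 t]) (vector [l4 t, l5 t, 0]) =
      vector [l5 t / (l3 t)\<^sup>2, - l4 t / (l3 t)\<^sup>2, - (l1 t * l5 t - l2 t * l4 t) / l3 t ^ 3]"
    using nz by (simp add: cross3_def vec_eq_iff forall_3 divide_simps power2_eq_square power3_eq_cube)
  finally have eq: "- (1 / l3 t ^ 3) *\<^sub>R cross3 p (q t) = R t *v
      vector [l5 t / (l3 t)\<^sup>2, - l4 t / (l3 t)\<^sup>2, - (l1 t * l5 t - l2 t * l4 t) / l3 t ^ 3]" .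
  have d3: "((\<lambda>t. 1 / l3 t) has_real_derivative - (l1 t * l5 t - l2 t * l4 t) / l3 t ^ 3) (at t)"
  proof -
    have cube: "- (u / c * inverse (c ^ Suc (Suc 0))) = - u / c ^ 3" for u c :: real
      by (simp add: numeral_3_eq_3 divide_inverse power_inverse mult.assoc)
    have "((\<lambda>t. inverse (l3 t)) has_real_derivative
        - (l1 t * l5 t - l2 t * l4 t) / l3 t ^ 3) (at t)"
      by (rule DERIV_cong[OF DERIV_inverse_fun[OF has_derivative_l3[OF assms] nz] cube])
    then show ?thesis
      unfolding inverse_eq_divide .
  qed
  have "(vector [0, 0, 1 / l3 t] :: real^3) = (1 / l3 t) *\<^sub>R vector [0, 0, 1]" for t
    by (simp add: vec_eq_iff forall_3)
  then have "g = (\<lambda>t. R t *v vector [0, 0, 1 / l3 t])"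
    by (simp add: projected_tangent_def tangent_def e_z_vector matrix_vector_mult_scaleR fun_eq_iff)
  then show ?thesis
    unfolding eq using has_derivative_frame[OF assms DERIV_const[of 0] DERIV_const[of 0] d3]
    by (simp add: power2_eq_square)
qed

lemma tangent_eq: "0 < l3 t \<Longrightarrow> tangent t = l3 t *\<^sub>R g t"
  by (simp add: projected_tangent_def)

text \<open>This is the function F of the overview. The factor \<open>W\<close> absorbs the
  orientation, so one sign covers both \<open>W > 0\<close> and \<open>W < 0\<close>.\<close>

definition "sweep a t = W * (cross3 p (q a) \<bullet> q t)"

lemma sweep_self: "sweep a a = 0"
  by (simp add: sweep_def dot_cross_self)

lemma sweep_swap: "sweep a b = - sweep b a"
  unfolding sweep_def by (simp add: cross3_simps)

lemma sweep_derivative_pos: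
  assumes a: "a \<in> I" and t: "t \<in> I" and "W \<noteq> 0"
  shows "\<exists>d>0. (sweep a has_real_derivative d) (at t)"
proof -
  \<comment> \<open>\<open>V\<close> is the derivative of \<open>sweep a\<close> divided by
    \<open>l3\<close>, simplified by Lagrange's identity. Since \<open>tangent a\<close> is
    orthogonal to \<open>q a\<close>, its value at \<open>a\<close> is the square of
    \<open>W\<close>, and (\<open>sweep a\<close>, \<open>V\<close>) is a cooperative
    system.\<close>
  define V where "V t = W * ((p \<bullet> p) * (q a \<bullet> g t) + W)" for t
  have F': "(sweep a has_real_derivative l3 t * V t) (at t)" if t: "t \<in> I" for t
  proof -
    have "q a \<bullet> tangent t = l3 t * (q a \<bullet> g t)"
      using tangent_eq l3_pos[OF t] by simp
    then have "cross3 p (q a) \<bullet> cross3 p (tangent t) = l3 t * ((p \<bullet> p) * (q a \<bullet> g t) + W)"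
      using interior_subset a t
      by (simp add: dot_cross_cross momentum_dot_tangent momentum_dot_angular inner_commute[of "q a" p]
          algebra_simps)
    then show ?thesis
      unfolding sweep_def V_def
      using has_real_derivative_inner_right[OF has_derivative_angular_momentum[OF t]]
      by (auto intro!: derivative_eq_intros)
  qed
  have V': "(V has_real_derivative (p \<bullet> p / l3 t ^ 3) * sweep a t) (at t)" if t: "t \<in> I" for t
  proof -
    have "(V has_real_derivative
        W * ((p \<bullet> p) * (q a \<bullet> (- (1 / l3 t ^ 3) *\<^sub>R cross3 p (q t))) + 0)) (at t)"
      unfolding V_def
      by (intro DERIV_add DERIV_cmult DERIV_const has_real_derivative_inner_right
          has_derivative_projected_tangent t)
    moreover have "q a \<bullet> cross3 p (q t) = - (cross3 p (q a) \<bullet> q t)"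
      by (simp add: cross3_simps)
    ultimately show ?thesis
      by (simp add: sweep_def mult_ac)
  qed
  have "0 < V t"
  proof (rule cooperative_system_pos[OF is_interval_interior a F' V' l3_pos _ sweep_self _ t])
    have "0 < W * W"
      using \<open>W \<noteq> 0\<close> by (metis not_real_square_gt_zero)
    then show "0 < V a"
      using interior_subset[OF a] tangent_dot_angular[of a]
      by (simp add: V_def projected_tangent_def inner_commute)
  qed (auto dest: l3_pos)
  then show ?thesis
    using F'[OF t] l3_pos[OF t] by (metis mult_pos_pos)
qed

lemma sweep_pos_interior:
  assumes "a \<in> I" "b \<in> I" "a < b" "W \<noteq> 0"
  shows "0 < sweep a b"
proof -
  have "\<exists>d. (sweep a has_real_derivative d) (at t) \<and> 0 < d" if "a \<le> t" "t \<le> b" for t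
    using sweep_derivative_pos[OF assms(1) _ assms(4), of t]
      mem_is_interval_1_I[OF is_interval_interior assms(1,2) that] by blast
  then show ?thesis
    using DERIV_pos_imp_increasing[OF assms(3), of "sweep a"] by (simp add: sweep_self)
qed

lemma eventually_contraction_interior:
  assumes "c \<in> I"
  shows "eventually (\<lambda>e. 0 < e \<and> e < 1 \<and> (\<forall>t\<in>D. t + e * (c - t) \<in> I)) (at_right (0::real))"
  using eventually_at_right_real[of 0 1]
  by (auto elim!: eventually_mono intro!: contraction_interior assms)

lemma contraction_strict_mono:
  fixes c e t u :: real
  assumes "e < 1" "t < u"
  shows "t + e * (c - t) < u + e * (c - u)"
proof -
  have "0 < (1 - e) * (u - t)" using assms by simp
  then show ?thesis by (simp add: algebra_simps)
qed

text \<open>The derivative is positive on both sides of \<open>a\<close>, so \<open>a\<close> may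
  lie anywhere relative to \<open>b\<close> and \<open>c\<close>. The limit to the closed domain
  keeps only the weak inequality.\<close>

lemma sweep_mono:
  assumes D: "a \<in> D" "b \<in> D" "c \<in> D" and "b < c" and "W \<noteq> 0"
  shows "sweep a b \<le> sweep a c"
proof -
  obtain k where k: "k \<in> I" using interior_nonempty by blast
  let ?f = "\<lambda>t e. t + e * (k - t)"
  have lim: "((\<lambda>e. sweep (?f t e) (?f u e)) \<longlongrightarrow> sweep t u) (at_right 0)" if "t \<in> D" "u \<in> D" for t u
    unfolding sweep_def
    by (intro tendsto_intros tendsto_cross3 that tendsto_contraction continuous_angular_momentum k)
  show ?thesis
  proof (rule tendsto_le[OF _ lim[OF D(1,3)] lim[OF D(1,2)]])
    show "eventually (\<lambda>e. sweep (?f a e) (?f b e) \<le> sweep (?f a e) (?f c e)) (at_right 0)"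
      using eventually_contraction_interior[OF k]
    proof eventually_elim
      case (elim e)
      then have I: "?f a e \<in> I" "?f b e \<in> I" "?f c e \<in> I" and "?f b e < ?f c e"
        using D \<open>b < c\<close> contraction_strict_mono by auto
      have "\<exists>d>0. (sweep (?f a e) has_real_derivative d) (at t)" if "?f b e \<le> t" "t \<le> ?f c e" for t
        using sweep_derivative_pos[OF I(1) _ \<open>W \<noteq> 0\<close>] I that is_interval_interior
        by (meson is_interval_1)
      then show ?case
        using DERIV_pos_imp_increasing[OF \<open>?f b e < ?f c e\<close>] by (meson less_imp_le)
    qed
  qed simp
qed

text \<open>Strictness is recovered at the ends by inserting interior points \<open>c < d\<close>
  between \<open>a\<close> and \<open>b\<close>: antisymmetry makes \<open>sweep\<close> monotone in
  its first argument too, and \<open>sweep c d\<close> is a positive lower bound.\<close>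

lemma sweep_pos:
  assumes "a \<in> D" "b \<in> D" "a < b" "W \<noteq> 0"
  shows "0 < sweep a b"
proof -
  define c d where "c = (2 * a + b) / 3" and "d = (a + 2 * b) / 3"
  have order: "a < c" "c < d" "d < b" and "0 \<le> a"
    using assms by (auto simp: c_def d_def geodesic_domain_def)
  then have I: "c \<in> I" "d \<in> I"
    using interior_below[OF assms(2)] by auto
  then have D: "c \<in> D" "d \<in> D"
    using interior_subset by auto
  have "0 < sweep c d"
    using sweep_pos_interior I order assms(4) by blast
  also have "\<dots> = - sweep d c" by (rule sweep_swap)
  also have "\<dots> \<le> - sweep d a"
    using sweep_mono[OF D(2) assms(1) D(1) order(1) assms(4)] by simp
  also have "\<dots> = sweep a d" by (rule sweep_swap[symmetric])
  also have "\<dots> \<le> sweep a b"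
    using sweep_mono[OF assms(1) D(2) assms(2) order(3) assms(4)] .
  finally show ?thesis .
qed

text \<open>The negated function has derivative \<open>sweep t b / l3 t ^ 3\<close> inside.
  Positivity of \<open>l3\<close> at \<open>t\<^sub>0\<close> and \<open>t\<^sub>1\<close> ensures
  continuity of \<open>g\<close> there even if these are ends of the domain.\<close>

lemma projected_tangent_decreasing:
  assumes D: "t\<^sub>0 \<in> D" "b \<in> D" and t: "t\<^sub>0 < t\<^sub>1" "t\<^sub>1 \<le> b"
    and pos: "0 < l3 t\<^sub>0" "0 < l3 t\<^sub>1" and "W \<noteq> 0"
  shows "W * (q b \<bullet> g t\<^sub>1) < W * (q b \<bullet> g t\<^sub>0)"
proof -
  have I: "t \<in> I" if "t\<^sub>0 < t" "t < t\<^sub>1" for t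
    using interior_below[OF D(2), of t] D(1) t that by (auto simp: geodesic_domain_def)
  have sub: "{t\<^sub>0..t\<^sub>1} \<subseteq> D"
    using domain_below[OF D(2)] D(1) t by (auto simp: geodesic_domain_def)
  have "0 < l3 t" if "t \<in> {t\<^sub>0..t\<^sub>1}" for t
    using that pos l3_pos[OF I, of t] by (cases "t = t\<^sub>0 \<or> t = t\<^sub>1") auto
  then have "continuous_on {t\<^sub>0..t\<^sub>1} (\<lambda>t. - (W * (q b \<bullet> g t)))"
    unfolding projected_tangent_def
    by (intro continuous_intros continuous_lam continuous_on_subset[OF continuous_tangent sub])
      fastforce
  moreover have "\<exists>d. ((\<lambda>t. - (W * (q b \<bullet> g t))) has_real_derivative d) (at t) \<and> 0 < d"
    if "t\<^sub>0 < t" "t < t\<^sub>1" for t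
  proof (intro exI conjI)
    note tI = I[OF that]
    have "((\<lambda>t. - (W * (q b \<bullet> g t))) has_real_derivative
        - (W * (q b \<bullet> (- (1 / l3 t ^ 3) *\<^sub>R cross3 p (q t))))) (at t)"
      by (intro DERIV_minus DERIV_cmult has_real_derivative_inner_right
          has_derivative_projected_tangent tI)
    also have "- (W * (q b \<bullet> (- (1 / l3 t ^ 3) *\<^sub>R cross3 p (q t)))) = sweep t b / l3 t ^ 3"
      by (simp add: sweep_def inner_commute)
    finally show "((\<lambda>t. - (W * (q b \<bullet> g t))) has_real_derivative sweep t b / l3 t ^ 3) (at t)" .
    show "0 < sweep t b / l3 t ^ 3"
      using sweep_pos[OF interior_subset[OF tI] D(2) _ \<open>W \<noteq> 0\<close>] l3_pos[OF tI] that t by simp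
  qed
  ultimately show ?thesis
    using DERIV_pos_imp_increasing_open[OF t(1), of "\<lambda>t. - (W * (q b \<bullet> g t))"] by simp
qed

section \<open>Orientation of triples of tangents\<close>

lemma tangent_triple_pos:
  assumes I: "t\<^sub>0 \<in> I" "t\<^sub>1 \<in> I" "t\<^sub>2 \<in> I" and t: "t\<^sub>0 < t\<^sub>1" "t\<^sub>1 < t\<^sub>2" and "W \<noteq> 0"
  shows "0 < W * (cross3 (tangent t\<^sub>0) (tangent t\<^sub>1) \<bullet> tangent t\<^sub>2)"
proof -
  let ?E = "\<lambda>t. W * (cross3 (g t\<^sub>0) (g t\<^sub>1) \<bullet> g t)"
  have pg: "p \<bullet> g t = 1" if "t \<in> I" for t
    using momentum_dot_tangent[OF interior_subset[OF that]] l3_pos[OF that]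
    by (simp add: projected_tangent_def)
  have "?E t\<^sub>1 < ?E t\<^sub>2"
  proof (rule DERIV_pos_imp_increasing[OF t(2)], intro exI conjI)
    fix t assume "t\<^sub>1 \<le> t" "t \<le> t\<^sub>2"
    then have tI: "t \<in> I"
      using I is_interval_interior by (meson is_interval_1)
    have "(?E has_real_derivative
        W * (cross3 (g t\<^sub>0) (g t\<^sub>1) \<bullet> (- (1 / l3 t ^ 3) *\<^sub>R cross3 p (q t)))) (at t)"
      by (intro DERIV_cmult has_real_derivative_inner_right has_derivative_projected_tangent tI)
    \<comment> \<open>Lagrange's identity, with \<open>p \<bullet> g = 1\<close> at both fixed
      times, leaves a difference that \<open>projected_tangent_decreasing\<close> makes
      positive.\<close>
    also have "W * (cross3 (g t\<^sub>0) (g t\<^sub>1) \<bullet> (- (1 / l3 t ^ 3) *\<^sub>R cross3 p (q t))) =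
        (W * (q t \<bullet> g t\<^sub>0) - W * (q t \<bullet> g t\<^sub>1)) / l3 t ^ 3"
      using pg I by (simp add: dot_cross_cross inner_commute[of _ p] inner_commute[of _ "q t"]
          algebra_simps diff_divide_distrib)
    finally show "(?E has_real_derivative
        (W * (q t \<bullet> g t\<^sub>0) - W * (q t \<bullet> g t\<^sub>1)) / l3 t ^ 3) (at t)" .
    show "0 < (W * (q t \<bullet> g t\<^sub>0) - W * (q t \<bullet> g t\<^sub>1)) / l3 t ^ 3"
      using projected_tangent_decreasing[OF interior_subset[OF I(1)] interior_subset[OF tI] t(1)
          \<open>t\<^sub>1 \<le> t\<close> l3_pos[OF I(1)] l3_pos[OF I(2)] \<open>W \<noteq> 0\<close>] l3_pos[OF tI]
      by simp
  qed
  then have "0 < ?E t\<^sub>2"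
    by (simp add: dot_cross_self)
  then have "0 < l3 t\<^sub>0 * l3 t\<^sub>1 * l3 t\<^sub>2 * ?E t\<^sub>2"
    using l3_pos I by simp
  then show ?thesis
    using I by (simp add: tangent_eq l3_pos cross_mult_left cross_mult_right algebra_simps)
qed

lemma tangent_triple_nonneg:
  assumes D: "t\<^sub>0 \<in> D" "t\<^sub>1 \<in> D" "t\<^sub>2 \<in> D" and t: "t\<^sub>0 < t\<^sub>1" "t\<^sub>1 < t\<^sub>2" and "W \<noteq> 0"
  shows "0 \<le> W * (cross3 (tangent t\<^sub>0) (tangent t\<^sub>1) \<bullet> tangent t\<^sub>2)"
proof -
  obtain k where k: "k \<in> I" using interior_nonempty by blast
  let ?f = "\<lambda>t e. t + e * (k - t)"
  show ?thesis
  proof (rule tendsto_lowerbound)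
    show "((\<lambda>e. W * (cross3 (tangent (?f t\<^sub>0 e)) (tangent (?f t\<^sub>1 e)) \<bullet> tangent (?f t\<^sub>2 e))) \<longlongrightarrow>
        W * (cross3 (tangent t\<^sub>0) (tangent t\<^sub>1) \<bullet> tangent t\<^sub>2)) (at_right 0)"
      by (intro tendsto_intros tendsto_cross3 D tendsto_contraction continuous_tangent k)
    show "eventually (\<lambda>e. 0 \<le> W * (cross3 (tangent (?f t\<^sub>0 e)) (tangent (?f t\<^sub>1 e)) \<bullet>
        tangent (?f t\<^sub>2 e))) (at_right 0)"
      using eventually_contraction_interior[OF k]
    proof eventually_elim
      case (elim e)
      then show ?case
        using D t \<open>W \<noteq> 0\<close> by (intro less_imp_le tangent_triple_pos contraction_strict_mono) auto
    qed
  qed simp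
qed

lemma tangent_0: "tangent 0 = e_z"
  using geodesic by (simp add: tangent_def cuspless_geodesic_def)

lemma l3_pos_0: "l3 0 \<noteq> 0 \<Longrightarrow> 0 < l3 0"
  using l3_nonneg[OF zero_in_domain] by simp

lemma tangent_not_parallel_initial:
  assumes s: "s \<in> D" "0 < s" and "W \<noteq> 0"
  shows "cross3 (tangent s) (tangent 0) \<noteq> 0"
proof
  assume cross: "cross3 (tangent s) (tangent 0) = 0"
  define \<kappa> where "\<kappa> = tangent 0 \<bullet> tangent s"
  \<comment> \<open>For a unit vector \<open>tangent 0\<close>, the double cross product is the part
    of \<open>tangent s\<close> orthogonal to it, here zero.\<close>
  have par: "tangent s = \<kappa> *\<^sub>R tangent 0"
    using double_cross[of "tangent 0" "tangent s"] cross tangent_unit[OF zero_in_domain]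
    by (simp add: \<kappa>_def)
  have sq: "\<kappa> * \<kappa> = 1"
    using tangent_unit[OF s(1)] tangent_unit[OF zero_in_domain] by (simp add: par)
  show False
  proof (cases "l3 0 = 0")
    case True
    \<comment> \<open>Here \<open>p\<close>, \<open>q 0\<close> and \<open>q s\<close> all lie in
      the plane orthogonal to \<open>tangent 0\<close>, so \<open>sweep 0 s\<close> would
      vanish.\<close>
    have "tangent 0 \<bullet> p = 0" "tangent 0 \<bullet> q 0 = 0" "tangent 0 \<bullet> q s = 0"
      using True momentum_dot_tangent[OF zero_in_domain] tangent_dot_angular[OF zero_in_domain]
        tangent_dot_angular[OF s(1)] sq
      by (auto simp: par inner_commute)
    moreover have "tangent 0 \<noteq> 0"
      using tangent_unit[OF zero_in_domain] by auto
    ultimately have "p \<bullet> cross3 (q 0) (q s) = 0"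
      using triple_product_eq_0_iff by blast
    then show False
      using sweep_pos[OF zero_in_domain s \<open>W \<noteq> 0\<close>]
      by (simp add: sweep_def triple_product_rotate)
  next
    case False
    then have pos: "0 < l3 0" by (rule l3_pos_0)
    have l3s: "l3 s = \<kappa> * l3 0"
      using momentum_dot_tangent[OF s(1)] momentum_dot_tangent[OF zero_in_domain] by (simp add: par)
    have "\<kappa> \<noteq> -1"
      using l3s l3_nonneg[OF s(1)] pos by auto
    then have "\<kappa> = 1"
      using sq square_eq_1_iff by blast
    then have "l3 s = l3 0" "g s = g 0"
      using l3s par by (auto simp: projected_tangent_def)
    then show False
      using projected_tangent_decreasing[OF zero_in_domain s(1) s(2) order_refl] pos \<open>W \<noteq> 0\<close> by simp
  qed
qed

section \<open>The curve itself and its velocity at the ends\<close>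

lemma has_derivative_curve: "t \<in> I \<Longrightarrow> (x has_vector_derivative tangent t) (at t)"
  using geodesic by (auto simp: cuspless_geodesic_def I_def tangent_def)

lemma continuous_curve: "continuous_on D x"
  using geodesic by (simp add: cuspless_geodesic_def)

lemma curve_0: "x 0 = 0"
  using geodesic by (simp add: cuspless_geodesic_def)

lemma segment_subset: "s \<in> D \<Longrightarrow> {0..s} \<subseteq> D"
  using domain_below by auto

text \<open>If the product vanished, the monotone function \<open>W * (N \<bullet> x t)\<close>
  would be zero at both ends of \<open>{0..s}\<close>, hence constant. All interior tangents would
  then be orthogonal to the nonzero \<open>N\<close>, contradicting
  \<open>tangent_triple_pos\<close>.\<close>

lemma triple_product_nonzero:
  assumes s: "s \<in> D" "0 < s" and "W \<noteq> 0"
  shows "e_z \<bullet> cross3 (x s) (tangent s) \<noteq> 0"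
proof
  assume zero: "e_z \<bullet> cross3 (x s) (tangent s) = 0"
  define N where "N = cross3 (tangent s) (tangent 0)"
  have int: "t \<in> I" if "0 < t" "t < s" for t
    using interior_below s that by blast
  have deriv: "((\<lambda>t. W * (N \<bullet> x t)) has_real_derivative W * (N \<bullet> tangent t)) (at t)"
    if "0 < t" "t < s" for t
    by (intro DERIV_cmult has_real_derivative_inner_right has_derivative_curve int that)
  have cyc: "N \<bullet> v = cross3 (tangent 0) v \<bullet> tangent s" for v
    unfolding N_def by (simp add: cross3_simps)
  have nonneg: "0 \<le> W * (N \<bullet> tangent t)" if "0 < t" "t < s" for t
    unfolding cyc
    by (rule tangent_triple_nonneg) (use that s zero_in_domain int interior_subset \<open>W \<noteq> 0\<close> in auto)
  have cont: "continuous_on {0..s} (\<lambda>t. W * (N \<bullet> x t))"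
    by (intro continuous_intros continuous_on_subset[OF continuous_curve] segment_subset s)
  have mono: "W * (N \<bullet> x t) \<le> W * (N \<bullet> x u)" if "0 \<le> t" "t \<le> u" "u \<le> s" for t u
  proof (rule DERIV_nonneg_imp_increasing_open[OF that(2)])
    show "continuous_on {t..u} (\<lambda>t. W * (N \<bullet> x t))"
      using cont by (rule continuous_on_subset) (use that in auto)
  next
    fix r assume "t < r" "r < u"
    then have "0 < r" "r < s" using that by auto
    then show "\<exists>y. ((\<lambda>t. W * (N \<bullet> x t)) has_real_derivative y) (at r) \<and> 0 \<le> y"
      using deriv nonneg by blast
  qed
  have end0: "W * (N \<bullet> x 0) = 0" "W * (N \<bullet> x s) = 0"
    using zero by (simp_all add: cyc curve_0 tangent_0 triple_product_rotate)
  have orth: "N \<bullet> tangent t = 0" if t: "0 < t" "t < s" for t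
  proof (rule ccontr)
    assume "N \<bullet> tangent t \<noteq> 0"
    then have "0 < W * (N \<bullet> tangent t)"
      using nonneg[OF t] \<open>W \<noteq> 0\<close> by (simp add: less_le)
    then obtain d where d: "d > 0"
      "\<And>h. 0 < h \<Longrightarrow> h < d \<Longrightarrow> W * (N \<bullet> x t) < W * (N \<bullet> x (t + h))"
      using DERIV_pos_inc_right[OF deriv[OF t]] by blast
    \<comment> \<open>A strict increase just after \<open>t\<close> could not be undone before
      \<open>s\<close>, where the value is again 0.\<close>
    define h where "h = min (s - t) (d / 2)"
    have h: "0 < h" "h < d" "t + h \<le> s"
      using d(1) t by (auto simp: h_def)
    show False
      using d(2)[OF h(1,2)] mono[of 0 t] mono[of "t + h" s] end0 h t by simp
  qed
  have I: "s / 4 \<in> I" "s / 2 \<in> I" "3 * s / 4 \<in> I"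
    using int s by auto
  have "tangent (s / 4) \<bullet> cross3 (tangent (s / 2)) (tangent (3 * s / 4)) \<noteq> 0"
    using tangent_triple_pos[OF I _ _ \<open>W \<noteq> 0\<close>] s by (auto simp: triple_product_rotate)
  moreover have "N \<noteq> 0"
    unfolding N_def using tangent_not_parallel_initial assms by blast
  ultimately show False
    using triple_product_eq_0_iff orth[of "s / 4"] orth[of "s / 2"] orth[of "3 * s / 4"] s(2)
    by auto
qed

text \<open>At the final end no derivative is assumed; it comes from writing \<open>x\<close> as the
  integral of the continuous function \<open>tangent\<close>.\<close>

lemma has_derivative_curve_segment:
  assumes s: "s \<in> D" "0 < s"
  shows "(x has_vector_derivative tangent s) (at s within {0..s})"
proof -
  have eq: "x t = integral {0..t} tangent" if t: "t \<in> {0..s}" for t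
  proof -
    have "(tangent has_integral x t - x 0) {0..t}"
    proof (rule fundamental_theorem_of_calculus_interior)
      show "continuous_on {0..t} x"
        using continuous_on_subset[OF continuous_curve segment_subset[OF s(1)]] t
        by (auto elim: continuous_on_subset)
      show "(x has_vector_derivative tangent r) (at r)" if "r \<in> {0<..<t}" for r
        using that t interior_below[OF s(1)] by (intro has_derivative_curve) auto
    qed (use t in auto)
    then show ?thesis
      by (simp add: curve_0 integral_unique)
  qed
  have "((\<lambda>t. integral {0..t} tangent) has_vector_derivative tangent s) (at s within {0..s})"
    using s by (intro integral_has_vector_derivative
        continuous_on_subset[OF continuous_tangent segment_subset]) auto
  then show ?thesis
    by (rule has_vector_derivative_transform[rotated 2]) (use s eq in auto)
qed

lemma velocity_eq_tangent:
  assumes s: "s \<in> D" "0 < s"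
  shows "velocity a1 a2 a4 a5 x s = tangent s"
  unfolding velocity_def
proof (rule vector_derivative_within)
  have "s islimpt {0..s}"
    using s(2) by (simp add: islimpt_Icc)
  then have "s islimpt D"
    using segment_subset[OF s(1)] islimpt_subset by blast
  then show "at s within D \<noteq> bot"
    by (simp add: trivial_limit_within)
  show "(x has_vector_derivative tangent s) (at s within D)"
  proof (cases "s \<in> I")
    case True
    then show ?thesis
      using has_derivative_curve has_vector_derivative_at_within by blast
  next
    case False
    \<comment> \<open>A positive point of \<open>D\<close> outside \<open>I\<close> can only be
      \<open>s_max\<close>.\<close>
    then have "D = {0..s}"
      using s interior_below[of _ s] segment_subset[OF s(1)]
      by (force simp: geodesic_domain_def)
    then show ?thesis
      using has_derivative_curve_segment[OF s] by simp
  qed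
qed

section \<open>Planarity and the first integral\<close>

text \<open>
  \<open>W = 0\<close> makes \<open>(\<lambda>\<^sub>4, \<lambda>\<^sub>5)\<close> stay on a fixed line, spanned by \<open>(m\<^sub>1, m\<^sub>2)\<close>, and the body vector
  \<open>(m\<^sub>1, m\<^sub>2, 0)\<close> is then constant in space.
\<close>

lemma planar_normal:
  assumes "W = 0"
  obtains n where "n \<noteq> 0" "n \<bullet> e_z = 0" "\<And>t. t \<in> D \<Longrightarrow> n \<bullet> x t = 0"
    "\<And>t. t \<in> D \<Longrightarrow> n \<bullet> tangent t = 0"
proof -
  \<comment> \<open>The direction is the initial value \<open>(a4, a5)\<close> or, if that is zero,
    the initial derivative \<open>(a2, - a1)\<close>; if both vanish any direction serves. In the
    first case the last equation is \<open>W = 0\<close>.\<close>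
  have "\<exists>m1 m2. (m1, m2) \<noteq> (0, 0) \<and> m2 * a4 = m1 * a5 \<and> m2 * a2 = - m1 * a1"
  proof (cases "(a4, a5) = (0, 0)")
    case True
    then show ?thesis
    proof (cases "(a2, a1) = (0, 0)")
      case False
      show ?thesis
        by (rule exI[where x = a2], rule exI[where x = "- a1"]) (use True False in auto)
    qed (use True in \<open>auto intro: exI[where x = 1]\<close>)
  next
    case False
    show ?thesis
      by (rule exI[where x = a4], rule exI[where x = a5])
        (use False assms in \<open>auto simp: W_integral_def algebra_simps\<close>)
  qed
  then obtain m1 m2 where m: "(m1, m2) \<noteq> (0, 0)" "m2 * a4 = m1 * a5" "m2 * a2 = - m1 * a1"
    by blast
  define n where "n = (vector [m1, m2, 0] :: real^3)"
  have line: "l4 t * m2 = l5 t * m1" for t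
  proof -
    have "l4 t * m2 = (m2 * a4) * cosh t + (m2 * a2) * sinh t"
      by (simp add: lam4_def algebra_simps)
    also have "\<dots> = l5 t * m1"
      unfolding m(2,3) by (simp add: lam5_def algebra_simps)
    finally show ?thesis .
  qed
  have zero: "(vector [0, 0, 0] :: real^3) = 0"
    by (simp add: vec_eq_iff forall_3)
  have const: "R t *v n = n" if t: "t \<in> D" for t
  proof (cases "t = 0")
    case True
    then show ?thesis using geodesic by (simp add: cuspless_geodesic_def)
  next
    case False
    then have pos: "0 < t" using t by (simp add: geodesic_domain_def)
    have "u \<bullet> (R t *v n) = u \<bullet> (R 0 *v n)" for u
    proof (rule DERIV_isconst_end[OF pos])
      have "continuous_on D (\<lambda>t. R t *v n)"
        unfolding n_def by (intro continuous_frame continuous_intros)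
      then show "continuous_on {0..t} (\<lambda>t. u \<bullet> (R t *v n))"
        using continuous_on_subset segment_subset[OF t] by (intro continuous_intros) blast
    next
      fix r assume "0 < r" "r < t"
      then have r: "r \<in> I" using interior_below t by blast
      have "((\<lambda>t. R t *v n) has_vector_derivative 0) (at r)"
        using has_derivative_frame[OF r DERIV_const[of m1] DERIV_const[of m2] DERIV_const[of 0]]
        by (simp add: line zero n_def)
      from has_real_derivative_inner_right[OF this, of u]
      show "((\<lambda>t. u \<bullet> (R t *v n)) has_real_derivative 0) (at r)"
        by simp
    qed
    then have "R t *v n = R 0 *v n" by (metis vector_eq_ldot)
    then show ?thesis using geodesic by (simp add: cuspless_geodesic_def)
  qed
  have tan: "n \<bullet> tangent t = 0" if t: "t \<in> D" for t
  proof -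
    have "n \<bullet> tangent t = (R t *v n) \<bullet> (R t *v e_z)"
      by (simp add: const[OF t] tangent_def)
    also have "\<dots> = n \<bullet> e_z"
      by (rule inner_rotation[OF t])
    finally show ?thesis
      by (simp add: n_def e_z_vector inner_vector_3)
  qed
  have curve: "n \<bullet> x t = 0" if t: "t \<in> D" for t
  proof (cases "t = 0")
    case False
    then have pos: "0 < t" using t by (simp add: geodesic_domain_def)
    have "n \<bullet> x t = n \<bullet> x 0"
    proof (rule DERIV_isconst_end[OF pos])
      show "continuous_on {0..t} (\<lambda>t. n \<bullet> x t)"
        by (intro continuous_intros continuous_on_subset[OF continuous_curve] segment_subset t)
    next
      fix r assume "0 < r" "r < t"
      then have r: "r \<in> I" using interior_below t by blast
      show "((\<lambda>t. n \<bullet> x t) has_real_derivative 0) (at r)"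
        using has_real_derivative_inner_right[OF has_derivative_curve[OF r], of n]
          tan[OF interior_subset[OF r]] by simp
    qed
    then show ?thesis by (simp add: curve_0)
  qed (simp add: curve_0)
  have "n \<noteq> 0"
    using m(1) by (auto simp: n_def vec_eq_iff forall_3)
  then show thesis
    using that curve tan tan[OF zero_in_domain] by (simp add: tangent_0)
qed

text \<open>Differentiating \<open>n \<bullet> x = 0\<close> gives the claim on the open set
  \<open>I\<close>; continuity of \<open>tangent\<close> extends it to the ends.\<close>

lemma normal_orthogonal_tangent:
  assumes n: "\<And>t. t \<in> D \<Longrightarrow> n \<bullet> x t = 0" and s: "s \<in> D"
  shows "n \<bullet> tangent s = 0"
proof -
  have interior: "n \<bullet> tangent t = 0" if t: "t \<in> I" for t
  proof (rule DERIV_unique)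
    show "((\<lambda>t. n \<bullet> x t) has_real_derivative n \<bullet> tangent t) (at t)"
      by (rule has_real_derivative_inner_right[OF has_derivative_curve[OF t]])
    have "open I"
      unfolding I_def
      by (intro open_Collect_conj open_Collect_less continuous_intros continuous_on_ereal)
    then have "eventually (\<lambda>u. u \<in> I) (nhds t)"
      using t by (rule eventually_nhds_in_open)
    then have "eventually (\<lambda>u. n \<bullet> x u = 0) (nhds t)"
      by eventually_elim (simp add: n interior_subset)
    from DERIV_cong_ev[OF refl this refl]
    show "((\<lambda>t. n \<bullet> x t) has_real_derivative 0) (at t)"
      by simp
  qed
  obtain k where k: "k \<in> I" using interior_nonempty by blast
  show ?thesis
  proof (rule tendsto_unique)
    show "((\<lambda>e. n \<bullet> tangent (s + e * (k - s))) \<longlongrightarrow> n \<bullet> tangent s) (at_right 0)"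
      by (intro tendsto_intros tendsto_contraction continuous_tangent k s)
    show "((\<lambda>e. n \<bullet> tangent (s + e * (k - s))) \<longlongrightarrow> 0) (at_right 0)"
      by (rule tendsto_eventually)
        (use eventually_contraction_interior[OF k] in eventually_elim, use interior s in auto)
  qed simp
qed

lemma planar_iff: "planar_curve D x \<longleftrightarrow> W = 0"
proof
  assume "planar_curve D x"
  moreover have "0 \<in> x ` D"
    using zero_in_domain curve_0 by (metis imageI)
  ultimately obtain n where n: "n \<noteq> 0" "\<And>t. t \<in> D \<Longrightarrow> n \<bullet> x t = 0"
    unfolding planar_curve_def using coplanar_iff_orthogonal by (metis imageI)
  obtain s where s: "s \<in> I" using interior_nonempty by blast
  then have "s \<in> D" "0 < s" by (auto simp: interior_subset I_def)
  \<comment> \<open>A normal to the whole curve is also normal to its tangents, in particular to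
    \<open>e_z\<close>, the tangent at 0.\<close>
  moreover have "e_z \<bullet> cross3 (x s) (tangent s) = 0"
    unfolding triple_product_eq_0_iff tangent_0[symmetric]
    using n normal_orthogonal_tangent[of n] \<open>s \<in> D\<close> zero_in_domain by blast
  ultimately show "W = 0"
    using triple_product_nonzero by blast
next
  assume "W = 0"
  then obtain n where "n \<noteq> 0" "\<And>t. t \<in> D \<Longrightarrow> n \<bullet> x t = 0"
    using planar_normal by metis
  moreover have "0 \<in> x ` D"
    using zero_in_domain curve_0 by (metis imageI)
  ultimately show "planar_curve D x"
    unfolding planar_curve_def using coplanar_iff_orthogonal by blast
qed

lemma triple_product_eq_0_iff_W:
  assumes s: "s \<in> D" "0 < s"
  shows "e_z \<bullet> cross3 (x s) (tangent s) = 0 \<longleftrightarrow> W = 0"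
proof
  assume "W = 0"
  then obtain n where "n \<noteq> 0" "n \<bullet> e_z = 0" "n \<bullet> x s = 0" "n \<bullet> tangent s = 0"
    using planar_normal s(1) by metis
  then show "e_z \<bullet> cross3 (x s) (tangent s) = 0"
    using triple_product_eq_0_iff by blast
qed (use triple_product_nonzero[OF s] in blast)

end

theorem theorem8:
  fixes a1 a2 a4 a5 :: real
    and x :: "real \<Rightarrow> real^3" and R :: "real \<Rightarrow> real^3^3" and s :: real
  assumes "cuspless_geodesic a1 a2 a4 a5 x R"
    and "0 < s" and "ereal s \<le> s_max a1 a2 a4 a5"
  shows "(coplanar_vectors e_z (x s) (velocity a1 a2 a4 a5 x s) \<longleftrightarrow>
            planar_curve (geodesic_domain a1 a2 a4 a5) x) \<and>
         (e_z \<bullet> cross3 (x s) (velocity a1 a2 a4 a5 x s) = 0 \<longleftrightarrow>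
            W_integral a1 a2 a4 a5 = 0)"
proof -
  interpret cuspless_curve a1 a2 a4 a5 x R
    by standard (rule assms(1))
  have s: "s \<in> D" "0 < s"
    using assms by (auto simp: geodesic_domain_def)
  have "coplanar_vectors u v w \<longleftrightarrow> u \<bullet> cross3 v w = 0" for u v w
    unfolding coplanar_vectors_def triple_product_eq_0_iff by (subst coplanar_iff_orthogonal) auto
  then show ?thesis
    using velocity_eq_tangent[OF s] planar_iff triple_product_eq_0_iff_W[OF s] by simp
qed

end
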